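(* Let $(X,\gamma)$ be a dynamical system and let $G$ be a group acting on $X$. Let $E:X\to\mathbb{R}$ (energy) and $C=(C_1,\dots,C_l):X\to\mathbb{R}^l$ (hylenic charge) be functionals satisfying the following assumptions. (EC-1) $E,C_1,\dots,C_l$ are $l+1$ prime integrals (integrals of motion) of $(X,\gamma)$, and $E(0)=0$, $C(0)=0$, $E'(0)=0$, $C'(0)=0$. (EC-2) $E$ and $C$ are $G$-invariant. (EC-3) There exist $a\ge 0$ and $s\ge 1$ such that: (i) $E(\mathbf{u})+a|C(\mathbf{u})|^s\ge 0$ for all $\mathbf{u}\in X$; (ii) if $\|\mathbf{u}\|\to\infty$, then $E(\mathbf{u})+a|C(\mathbf{u})|^s\to\infty$; (iii) for any sequence $\mathbf{u}_n$ in $X$ with $E(\mathbf{u}_n)+a|C(\mathbf{u}_n)|^s\to 0$, we have $\mathbf{u}_n\to 0$ in $X$. (EC-4) $E$ and $|C|$ satisfy the splitting property. Let $\|\cdot\|_\sharp$ be an auxiliary norm (or seminorm) on $X$, put $$\Lambda(\mathbf{u})=\frac{E(\mathbf{u})}{|C(\mathbf{u})|},\qquad \Lambda_0:=\liminf_{\|\mathbf{u}\|_\sharp\to 0}\Lambda(\mathbf{u}),$$ and assume that $$\inf_{\mathbf{u}\in X}\Lambda(\mathbf{u})<\Lambda_0 .$$ Then there are $\bar\delta>0$ and a family of values of the charge $c_\delta$, $\delta\in(0,\bar\delta)$, such that, for all $\delta\in(0,\bar\delta)$, the minimum $$e_\delta=\min\{E(\mathbf{u}) : C(\mathbf{u})=c_\delta\}$$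 exists and the set of minimizers $\Gamma_\delta$ is $G$-compact. Moreover, $\Gamma_\delta$ can be characterized also as the set of minimizers of the functional $$J_\delta(\mathbf{u})=\Lambda(\mathbf{u})+\delta\,\Phi(\mathbf{u}),\qquad \Phi(\mathbf{u})=E(\mathbf{u})+2a|C(\mathbf{u})|^s,$$ where $a,s$ are the constants in (EC-3), and $J_\delta$ is a $G$-compact functional.
   Context: Setting. $X$ is a (real) Banach space with norm $\|\cdot\|$. $\gamma:\mathbb{R}\times X\to X$, $(t,\mathbf{u})\mapsto\gamma_t\mathbf{u}$, is the time evolution map (a flow) of the dynamical system $(X,\gamma)$. A functional $F$ on $X$ is an integral of motion (prime integral) if $F(\gamma_t\mathbf{u})=F(\mathbf{u})$ for all $t\in\mathbb{R}$, $\mathbf{u}\in X$. The functionals $E$ and $C$ are of class $C^1$. $G$-notions. A functional $J$ is $G$-invariant if $J(g\mathbf{u})=J(\mathbf{u})$ for all $g\in G$, $\mathbf{u}\in X$. A non-empty set $\Gamma\subset X$ is $G$-invariant if $g\mathbf{u}\in\Gamma$ for all $\mathbf{u}\in\Gamma$, $g\in G$. A closed $G$-invariant set $\Gamma\subset X$ is $G$-compact if for any sequence $\mathbf{u}_n$ in $\Gamma$ there is a sequence $g_n\in G$ such that $g_n\mathbf{u}_n$ has a converging subsequence. A sequence $\mathbf{u}_n$ in $X$ is $G$-compact if there are a subsequence $\mathbf{u}_{n_k}$ and a sequence $g_k\in G$ such that $g_k\mathbf{u}_{n_k}$ is convergent. A functional $J$ is $G$-compact if any minimizing sequence of $J$ is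 $G$-compact. Splitting property. A functional $F$ on $X$ has the splitting property if, for every sequence $\mathbf{u}_n=\mathbf{u}+\mathbf{w}_n\in X$ such that $\mathbf{w}_n$ converges weakly to $0$, one has $F(\mathbf{u}_n)=F(\mathbf{u})+F(\mathbf{w}_n)+o(1)$ as $n\to\infty$. Auxiliary norm. A norm (or seminorm) $\|\cdot\|_\sharp$ on $X$ is auxiliary if for any sequence $\mathbf{u}_n$ bounded in $X$ with $\|\mathbf{u}_n\|_\sharp\ge\delta>0$ for some constant $\delta$, one can extract a subsequence $\mathbf{u}_{n_k}$ and choose $g_k\in G$ such that $g_k\mathbf{u}_{n_k}$ converges weakly to some $\bar{\mathbf{u}}\ne 0$. Convention. $\Lambda$ and $J_\delta$ (and the corresponding $\inf$, $\liminf$ and minimizers) are considered for $\mathbf{u}$ with $C(\mathbf{u})\neq 0$; $|C(\mathbf{u})|$ is the Euclidean norm in $\mathbb{R}^l$. The values of the charge $c_\delta$ are elements of $\mathbb{R}^l$.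
   Formalization: Γ_δ is shown to be the set of minimizers of J_δ having charge c_δ, and the minimizers of J_δ are the union of the energy minimizers at the charges they attain; literal equality fails, e.g. X=ℝ, E=u², C=u³, a=0, where J_δ has two minimizers ±(2δ)^(-1/3) of opposite charge. *)

theory Defs
  imports "HOL-Analysis.Analysis" "HOL-Algebra.Group_Action"
begin

text \<open>The time evolution map satisfies the one-parameter group law; no continuity is required.\<close>

definition flow :: "(real \<Rightarrow> 'x \<Rightarrow> 'x) \<Rightarrow> bool" where
  "flow \<gamma> \<longleftrightarrow> (\<forall>u. \<gamma> 0 u = u) \<and> (\<forall>s t u. \<gamma> (s + t) u = \<gamma> s (\<gamma> t u))"

definition prime_integral :: "(real \<Rightarrow> 'x \<Rightarrow> 'x) \<Rightarrow> ('x \<Rightarrow> real) \<Rightarrow> bool" where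
  "prime_integral \<gamma> F \<longleftrightarrow> (\<forall>t u. F (\<gamma> t u) = F u)"

definition class_C1 :: "('x::real_normed_vector \<Rightarrow> 'y::real_normed_vector) \<Rightarrow> bool" where
  "class_C1 F \<longleftrightarrow>
     (\<exists>F' :: 'x \<Rightarrow> 'x \<Rightarrow>\<^sub>L 'y.
        (\<forall>u. (F has_derivative blinfun_apply (F' u)) (at u)) \<and> continuous_on UNIV F')"

definition weakly_converges :: "(nat \<Rightarrow> 'x::real_normed_vector) \<Rightarrow> 'x \<Rightarrow> bool" where
  "weakly_converges w x \<longleftrightarrow>
     (\<forall>f :: 'x \<Rightarrow> real. bounded_linear f \<longrightarrow> (\<lambda>n. f (w n)) \<longlonglongrightarrow> f x)"

definition splitting :: "('x::real_normed_vector \<Rightarrow> real) \<Rightarrow> bool" where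
  "splitting F \<longleftrightarrow>
     (\<forall>u w. weakly_converges w 0 \<longrightarrow> (\<lambda>n. F (u + w n) - (F u + F (w n))) \<longlonglongrightarrow> 0)"

text \<open>
  Below, the group \<open>G\<close> acts on the whole space through \<open>\<phi>\<close>, where \<open>\<phi> g u\<close> stands for \<open>g u\<close>.
  The action is an action on the underlying set; it is neither linear nor continuous in general.
\<close>

definition G_invariant_fun ::
  "('g, 'm) monoid_scheme \<Rightarrow> ('g \<Rightarrow> 'x \<Rightarrow> 'x) \<Rightarrow> ('x \<Rightarrow> 'y) \<Rightarrow> bool" where
  "G_invariant_fun G \<phi> J \<longleftrightarrow> (\<forall>g\<in>carrier G. \<forall>u. J (\<phi> g u) = J u)"

definition G_invariant_set ::
  "('g, 'm) monoid_scheme \<Rightarrow> ('g \<Rightarrow> 'x \<Rightarrow> 'x) \<Rightarrow> 'x set \<Rightarrow> bool" where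
  "G_invariant_set G \<phi> \<Gamma> \<longleftrightarrow> \<Gamma> \<noteq> {} \<and> (\<forall>g\<in>carrier G. \<forall>u\<in>\<Gamma>. \<phi> g u \<in> \<Gamma>)"

definition G_compact_set ::
  "('g, 'm) monoid_scheme \<Rightarrow> ('g \<Rightarrow> 'x \<Rightarrow> 'x::real_normed_vector) \<Rightarrow> 'x set \<Rightarrow> bool" where
  "G_compact_set G \<phi> \<Gamma> \<longleftrightarrow>
     closed \<Gamma> \<and> G_invariant_set G \<phi> \<Gamma> \<and>
     (\<forall>u :: nat \<Rightarrow> 'x. (\<forall>n. u n \<in> \<Gamma>) \<longrightarrow>
        (\<exists>g r. (\<forall>n. g n \<in> carrier G) \<and> strict_mono (r :: nat \<Rightarrow> nat) \<and>
               convergent ((\<lambda>n. \<phi> (g n) (u n)) \<circ> r)))"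

definition G_compact_seq ::
  "('g, 'm) monoid_scheme \<Rightarrow> ('g \<Rightarrow> 'x \<Rightarrow> 'x::real_normed_vector) \<Rightarrow> (nat \<Rightarrow> 'x) \<Rightarrow> bool" where
  "G_compact_seq G \<phi> u \<longleftrightarrow>
     (\<exists>r g. strict_mono (r :: nat \<Rightarrow> nat) \<and> (\<forall>k. g k \<in> carrier G) \<and>
            convergent (\<lambda>k. \<phi> (g k) (u (r k))))"

definition minimizing_seq :: "'x set \<Rightarrow> ('x \<Rightarrow> real) \<Rightarrow> (nat \<Rightarrow> 'x) \<Rightarrow> bool" where
  "minimizing_seq D J u \<longleftrightarrow>
     (\<forall>n. u n \<in> D) \<and> (\<lambda>n. ereal (J (u n))) \<longlonglongrightarrow> (INF v\<in>D. ereal (J v))"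

definition G_compact_fun ::
  "('g, 'm) monoid_scheme \<Rightarrow> ('g \<Rightarrow> 'x \<Rightarrow> 'x::real_normed_vector) \<Rightarrow> 'x set \<Rightarrow> ('x \<Rightarrow> real) \<Rightarrow> bool"
  where
  "G_compact_fun G \<phi> D J \<longleftrightarrow> (\<forall>u. minimizing_seq D J u \<longrightarrow> G_compact_seq G \<phi> u)"

definition minimizers :: "'x set \<Rightarrow> ('x \<Rightarrow> real) \<Rightarrow> 'x set" where
  "minimizers D J = {u. is_arg_min J (\<lambda>v. v \<in> D) u}"

text \<open>Nonnegativity of a seminorm follows from the two conditions.\<close>

definition seminorm :: "('x::real_vector \<Rightarrow> real) \<Rightarrow> bool" where
  "seminorm p \<longleftrightarrow> (\<forall>x y. p (x + y) \<le> p x + p y) \<and> (\<forall>c x. p (c *\<^sub>R x) = \<bar>c\<bar> * p x)"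

definition auxiliary_seminorm ::
  "('g, 'm) monoid_scheme \<Rightarrow> ('g \<Rightarrow> 'x \<Rightarrow> 'x::real_normed_vector) \<Rightarrow> ('x \<Rightarrow> real) \<Rightarrow> bool" where
  "auxiliary_seminorm G \<phi> p \<longleftrightarrow>
     seminorm p \<and>
     (\<forall>(u :: nat \<Rightarrow> 'x) \<delta>. bounded (range u) \<and> \<delta> > 0 \<and> (\<forall>n. p (u n) \<ge> \<delta>) \<longrightarrow>
        (\<exists>r g ubar. strict_mono (r :: nat \<Rightarrow> nat) \<and> (\<forall>k. g k \<in> carrier G) \<and>
           ubar \<noteq> 0 \<and> weakly_converges (\<lambda>k. \<phi> (g k) (u (r k))) ubar))"

definition charged :: "('x \<Rightarrow> real ^ 'l) \<Rightarrow> 'x set" where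
  "charged C = {u. C u \<noteq> 0}"

definition Lam :: "('x \<Rightarrow> real) \<Rightarrow> ('x \<Rightarrow> real ^ 'l) \<Rightarrow> 'x \<Rightarrow> real" where
  "Lam E C u = E u / norm (C u)"

text \<open>
  The lower limit is taken along charged \<open>u\<close> with \<open>p u \<rightarrow> 0\<close>. As \<open>p\<close> may be a seminorm, points
  with \<open>p u = 0\<close> are not excluded. The value is \<open>\<infinity>\<close> if \<open>p\<close> is bounded away from \<open>0\<close> on the
  charged elements.
\<close>

definition Lam0 :: "('x \<Rightarrow> real) \<Rightarrow> ('x \<Rightarrow> real) \<Rightarrow> ('x \<Rightarrow> real ^ 'l) \<Rightarrow> ereal" where
  "Lam0 p E C =
     Liminf (inf (filtercomap p (nhds 0)) (principal (charged C))) (\<lambda>u. ereal (Lam E C u))"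

definition Phi :: "real \<Rightarrow> real \<Rightarrow> ('x \<Rightarrow> real) \<Rightarrow> ('x \<Rightarrow> real ^ 'l) \<Rightarrow> 'x \<Rightarrow> real" where
  "Phi a s E C u = E u + 2 * a * norm (C u) powr s"

definition Jfun :: "real \<Rightarrow> real \<Rightarrow> ('x \<Rightarrow> real) \<Rightarrow> ('x \<Rightarrow> real ^ 'l) \<Rightarrow> real \<Rightarrow> 'x \<Rightarrow> real" where
  "Jfun a s E C \<delta> u = Lam E C u + \<delta> * Phi a s E C u"

end

theory Submission
  imports Defs
begin

text \<open>
  Fixing the charge makes compactness hard, so the charge is first left free and \<open>J = \<Lambda> + \<delta> \<Phi>\<close> is minimized
  among charged elements; the charge of a minimizer of \<open>J\<close> then serves as the value \<open>c \<delta>\<close>. On a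
  level of constant charge, \<open>J\<close> is an increasing affine function of \<open>E\<close>, hence both functionals have
  the same minimizers there (\<open>constrained_minimizers_eq\<close>).

  A minimizing sequence of \<open>J\<close> has bounded shifted energy \<open>E + a |C|\<^sup>s\<close>, because the penalty dominates the
  possibly negative part of \<open>\<Lambda>\<close> (\<open>Jfun_sublevel_bounds\<close>); so it is bounded in norm. For small \<open>\<delta>\<close> the
  infimum of \<open>J\<close> lies strictly below \<open>\<Lambda>\<^sub>0\<close>, and since \<open>\<Phi> \<ge> 0\<close> the auxiliary seminorm stays away from
  zero along the sequence. Modulo the group, a subsequence thus has a weak limit \<open>u \<noteq> 0\<close>.

  Weak convergence is strong for the following reason (\<open>minimizing_weak_limit_is_strong\<close>). By splitting,
  the energies and the charges of \<open>u\<close> and of the remainder \<open>w\<close> add up asymptotically. The ratio \<open>\<Lambda>\<close> of the whole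
  is a mediant of the ratios of the parts, hence at least one of them, while \<open>\<Phi>\<close> is superadditive because
  \<open>s \<ge> 1\<close>. So the value of \<open>J\<close> on the whole is at least its value on one part plus \<open>\<delta> \<Phi>\<close> of the other
  part. Losing \<open>\<delta> \<Phi> u > 0\<close> would push \<open>J w\<close> below the infimum; therefore the loss is \<open>\<delta> \<Phi> w\<close>, which must
  tend to zero, and this forces \<open>w\<close> to tend to zero in norm.
\<close>

section \<open>Inequalities and limits of real numbers\<close>

lemma powr_superadditive:
  fixes x y s :: real
  assumes "x \<ge> 0" "y \<ge> 0" "s \<ge> 1"
  shows "x powr s + y powr s \<le> (x + y) powr s"
proof -
  have split_off: "z powr s = z * z powr (s - 1)" if "z \<ge> 0" for z :: real
    using that powr_mult_base[of z "s - 1"] by simp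
  have "x powr s + y powr s = x * x powr (s - 1) + y * y powr (s - 1)"
    using assms split_off by simp
  also have "\<dots> \<le> x * (x + y) powr (s - 1) + y * (x + y) powr (s - 1)"
    using assms by (intro add_mono mult_left_mono powr_mono2) auto
  also have "\<dots> = (x + y) powr s"
    using assms split_off[of "x + y"] by (simp add: distrib_right)
  finally show ?thesis .
qed

text \<open>
  A mediant lies between the two fractions. A fraction with zero denominator and nonnegative
  numerator only raises the mediant, so it can be ignored.
\<close>

lemma mediant_ge_one_fraction:
  fixes e1 e2 n1 n2 :: real
  assumes "n1 \<ge> 0" "n2 \<ge> 0" "n1 + n2 > 0"
    and "n1 = 0 \<Longrightarrow> e1 \<ge> 0" "n2 = 0 \<Longrightarrow> e2 \<ge> 0"
  obtains "n1 > 0" "e1 / n1 \<le> (e1 + e2) / (n1 + n2)"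
    | "n2 > 0" "e2 / n2 \<le> (e1 + e2) / (n1 + n2)"
proof -
  consider "n1 = 0" | "n2 = 0" | "n1 > 0" "n2 > 0" "e1 * n2 \<le> e2 * n1"
    | "n1 > 0" "n2 > 0" "e2 * n1 \<le> e1 * n2"
    using assms(1,2) by linarith
  then show thesis
  proof cases
    case 1
    then show ?thesis using assms that(2) by (simp add: divide_right_mono)
  next
    case 2
    then show ?thesis using assms that(1) by (simp add: divide_right_mono)
  next
    case 3
    then show ?thesis using that(1) by (simp add: field_simps)
  next
    case 4
    then show ?thesis using that(2) by (simp add: field_simps)
  qed
qed

lemma tendsto_zero_mult_Bseq:
  fixes x y :: "nat \<Rightarrow> real"
  assumes "Bseq x" "y \<longlonglongrightarrow> 0"
  shows "(\<lambda>k. x k * y k) \<longlonglongrightarrow> 0"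
  using bounded_bilinear.Bfun_prod_Zfun[OF bounded_bilinear_mult assms(1)] assms(2)
  by (simp add: tendsto_Zfun_iff)

text \<open>
  Boundedness is imposed on the quotients instead of the numerators and denominators, in order to
  cover charges that are unbounded along the sequence.
\<close>

lemma quotient_diff_tendsto_zero:
  fixes e e' n n' :: "nat \<Rightarrow> real"
  assumes e: "(\<lambda>k. e k - e' k) \<longlonglongrightarrow> 0" and n: "(\<lambda>k. n k - n' k) \<longlonglongrightarrow> 0"
    and m: "m > 0" "\<forall>\<^sub>F k in sequentially. n k \<ge> m"
    and q: "Bseq (\<lambda>k. e k / n k)"
  shows "(\<lambda>k. e k / n k - e' k / n' k) \<longlonglongrightarrow> 0"
proof -
  have "\<forall>\<^sub>F k in sequentially. n k - n' k < m / 2"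
    using order_tendstoD(2)[OF n, of "m / 2"] m(1) by simp
  then have n'_ge: "\<forall>\<^sub>F k in sequentially. n' k \<ge> m / 2"
    using m(2) by eventually_elim linarith
  have "(\<lambda>k. (e k / n k) * (n k - n' k)) \<longlonglongrightarrow> 0"
    using q n by (rule tendsto_zero_mult_Bseq)
  then have d: "(\<lambda>k. (e k - e' k) - (e k / n k) * (n k - n' k)) \<longlonglongrightarrow> 0"
    using tendsto_diff[OF e] by fastforce
  have bound: "\<forall>\<^sub>F k in sequentially.
      \<bar>e k / n k - e' k / n' k\<bar> \<le> (2 / m) * \<bar>(e k - e' k) - (e k / n k) * (n k - n' k)\<bar>"
    using m(2) n'_ge
  proof eventually_elim
    case (elim k)
    then have pos: "n k > 0" "n' k > 0" using m(1) by auto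
    have "e k / n k - e' k / n' k = ((e k - e' k) - (e k / n k) * (n k - n' k)) / n' k"
      using pos by (simp add: field_simps)
    moreover have "1 / n' k \<le> 2 / m" using elim m(1) pos by (simp add: field_simps)
    ultimately show ?case
      using pos mult_right_mono[of "1 / n' k" "2 / m"
          "\<bar>(e k - e' k) - (e k / n k) * (n k - n' k)\<bar>"] by (simp add: abs_divide)
  qed
  have "(\<lambda>k. (2 / m) * \<bar>(e k - e' k) - (e k / n k) * (n k - n' k)\<bar>) \<longlonglongrightarrow> 0"
    using tendsto_mult_right_zero[OF tendsto_rabs_zero[OF d]] by blast
  then have "(\<lambda>k. \<bar>e k / n k - e' k / n' k\<bar>) \<longlonglongrightarrow> 0"
    by (rule tendsto_sandwich[OF _ bound tendsto_const, rotated]) simp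
  then show ?thesis by (rule tendsto_rabs_zero_cancel)
qed

lemma powr_diff_tendsto_zero:
  fixes x y :: "nat \<Rightarrow> real"
  assumes d: "(\<lambda>k. x k - y k) \<longlonglongrightarrow> 0" and nonneg: "\<And>k. x k \<ge> 0" "\<And>k. y k \<ge> 0"
    and bdd: "Bseq x" and s: "s > 0"
  shows "(\<lambda>k. x k powr s - y k powr s) \<longlonglongrightarrow> 0"
proof -
  have "Bseq (\<lambda>k. x k - y k)"
    using d convergent_imp_Bseq convergentI by blast
  then obtain K1 K2 where K: "\<And>k. \<bar>x k\<bar> \<le> K1" "\<And>k. \<bar>x k - y k\<bar> \<le> K2"
    using bdd unfolding Bseq_def by (metis real_norm_def)
  define R where "R = K1 + K2"
  have "0 \<le> K2" using K(2)[of 0] by linarith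
  then have mem: "x k \<in> {0..R}" "y k \<in> {0..R}" for k
    using K(1)[of k] K(2)[of k] nonneg[of k] unfolding R_def by auto
  have "continuous_on {0..R} (\<lambda>z. z powr s)"
    using s by (intro continuous_on_powr' continuous_on_id continuous_on_const) auto
  then have "uniformly_continuous_on {0..R} (\<lambda>z. z powr s)"
    using compact_Icc by (rule compact_uniformly_continuous)
  moreover have "(\<lambda>k. dist (x k) (y k)) \<longlonglongrightarrow> 0"
    using tendsto_rabs_zero[OF d] by (simp add: dist_real_def)
  ultimately have "(\<lambda>k. dist (x k powr s) (y k powr s)) \<longlonglongrightarrow> 0"
    using mem unfolding uniformly_continuous_on_sequentially
    by (elim conjE allE[of _ x] allE[of _ y]) simp
  then show ?thesis
    unfolding dist_real_def by (rule tendsto_rabs_zero_cancel)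
qed

section \<open>Energy and charge\<close>

locale energy_charge =
  fixes E :: "'x::real_normed_vector \<Rightarrow> real"
    and C :: "'x \<Rightarrow> real ^ 'l"
    and a s :: real
  assumes continuous: "continuous_on UNIV E" "continuous_on UNIV C"
    and zero: "E 0 = 0" "C 0 = 0"
    and parameters: "a \<ge> 0" "s \<ge> 1"
    and shifted_nonneg: "\<And>u. E u + a * norm (C u) powr s \<ge> 0"
    and shifted_coercive: "filterlim (\<lambda>u. E u + a * norm (C u) powr s) at_top at_infinity"
    and shifted_zero: "\<And>u :: nat \<Rightarrow> 'x.
          (\<lambda>n. E (u n) + a * norm (C (u n)) powr s) \<longlonglongrightarrow> 0 \<Longrightarrow> u \<longlonglongrightarrow> 0"
    and splitting_E: "splitting E"
    and splitting_C: "splitting (\<lambda>u. norm (C u))"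
begin

definition shifted_energy :: "'x \<Rightarrow> real" where
  "shifted_energy u = E u + a * norm (C u) powr s"

lemma shifted_energy_nonneg: "shifted_energy u \<ge> 0"
  using shifted_nonneg by (simp add: shifted_energy_def)

lemma Phi_eq_shifted: "Phi a s E C u = shifted_energy u + a * norm (C u) powr s"
  by (simp add: Phi_def shifted_energy_def)

lemma shifted_energy_le_Phi: "shifted_energy u \<le> Phi a s E C u"
  using parameters by (simp add: Phi_eq_shifted)

lemma Phi_nonneg: "Phi a s E C u \<ge> 0"
  using shifted_energy_le_Phi shifted_energy_nonneg order_trans by blast

lemma shifted_energy_eq_zero: "shifted_energy u = 0 \<Longrightarrow> u = 0"
  using shifted_zero[of "\<lambda>_. u"] by (simp add: shifted_energy_def LIMSEQ_const_iff)

lemma Phi_pos: "u \<noteq> 0 \<Longrightarrow> Phi a s E C u > 0"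
  using shifted_energy_eq_zero[of u] shifted_energy_nonneg[of u] shifted_energy_le_Phi[of u]
  by linarith

lemma energy_nonneg_if_uncharged: "C u = 0 \<Longrightarrow> E u \<ge> 0"
  using shifted_nonneg[of u] by simp

text \<open>
  The general fact that weak and strong limits agree rests on the Hahn-Banach theorem. The splitting
  property replaces it here: along such a sequence it gives \<open>E u + E (- u) = 0\<close> and
  \<open>C u = C (- u) = 0\<close>, and the shifted energy vanishes only at the origin.
\<close>

lemma weak_limit_of_null_seq:
  fixes u :: 'x
  assumes weak: "weakly_converges (\<lambda>k. v k - u) 0" and null: "v \<longlonglongrightarrow> 0"
  shows "u = 0"
proof -
  have split_at_limit: "F u + F (- u) = 0"
    if F: "splitting F" "continuous_on UNIV F" "F 0 = 0" for F :: "'x \<Rightarrow> real"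
  proof -
    have "(\<lambda>k. F (u + (v k - u)) - (F u + F (v k - u))) \<longlonglongrightarrow> 0"
      using F(1) weak unfolding splitting_def by blast
    moreover have "(\<lambda>k. F (u + (v k - u)) - (F u + F (v k - u))) \<longlonglongrightarrow> F (u + (0 - u)) - (F u + F (0 - u))"
      by (intro tendsto_intros continuous_on_tendsto_compose[OF F(2)] null) (use null in auto)
    ultimately show ?thesis
      using F(3) LIMSEQ_unique by fastforce
  qed
  have "E u + E (- u) = 0"
    using split_at_limit[OF splitting_E] continuous zero by simp
  moreover have "norm (C u) + norm (C (- u)) = 0"
    using split_at_limit[OF splitting_C] continuous zero by (simp add: continuous_on_norm)
  then have "C u = 0" "C (- u) = 0"
    by (simp_all add: add_nonneg_eq_0_iff)
  ultimately have "shifted_energy u = 0"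
    using energy_nonneg_if_uncharged[of u] energy_nonneg_if_uncharged[of "- u"]
    by (simp add: shifted_energy_def)
  then show ?thesis by (rule shifted_energy_eq_zero)
qed

lemma bounded_if_shifted_energy_bounded:
  assumes "\<And>n. shifted_energy (u n) \<le> K"
  shows "bounded (range u)"
proof -
  have "\<forall>\<^sub>F x in at_infinity. shifted_energy x > K"
    using shifted_coercive unfolding filterlim_at_top_dense shifted_energy_def by blast
  then obtain b where "\<And>x. norm x \<ge> b \<Longrightarrow> shifted_energy x > K"
    unfolding eventually_at_infinity by blast
  then have "norm (u n) \<le> b" for n
    using assms[of n] by (meson not_less linear)
  then show ?thesis unfolding bounded_iff by blast
qed

section \<open>The penalized functional\<close>

text \<open>
  This decomposition isolates the only negative contribution to the penalized functional, which is
  confined to charges \<open>norm (C u) < 1 / \<delta>\<close>.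
\<close>

lemma Jfun_decomposition:
  assumes "C u \<noteq> 0"
  shows "Jfun a s E C \<delta> u = shifted_energy u / norm (C u) + \<delta> * shifted_energy u
           + a * norm (C u) powr (s - 1) * (\<delta> * norm (C u) - 1)"
proof -
  have "norm (C u) powr s = norm (C u) * norm (C u) powr (s - 1)"
    using powr_mult_base[of "norm (C u)" "s - 1"] by simp
  then show ?thesis
    using assms by (simp add: Jfun_def Lam_def Phi_def shifted_energy_def field_simps)
qed

lemma negative_part_bound:
  assumes "\<delta> > 0"
  shows "a * norm (C u) powr (s - 1) * (\<delta> * norm (C u) - 1) \<ge> - (a * (1 / \<delta>) powr (s - 1))"
proof (cases "\<delta> * norm (C u) \<ge> 1")
  case True
  then have "0 \<le> a * norm (C u) powr (s - 1) * (\<delta> * norm (C u) - 1)"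
    using parameters by simp
  moreover have "0 \<le> a * (1 / \<delta>) powr (s - 1)" using parameters by simp
  ultimately show ?thesis by linarith
next
  case False
  then have "norm (C u) \<le> 1 / \<delta>" using assms by (simp add: field_simps)
  then have le: "a * norm (C u) powr (s - 1) \<le> a * (1 / \<delta>) powr (s - 1)"
    using parameters by (intro mult_left_mono powr_mono2) auto
  have "a * norm (C u) powr (s - 1) * (\<delta> * norm (C u) - 1) \<ge> a * norm (C u) powr (s - 1) * (- 1)"
    using parameters assms by (intro mult_left_mono) auto
  then show ?thesis using le by linarith
qed

lemma Jfun_bounded_below:
  assumes "\<delta> > 0" "C u \<noteq> 0"
  shows "Jfun a s E C \<delta> u \<ge> - (a * (1 / \<delta>) powr (s - 1))"
proof -
  have "shifted_energy u / norm (C u) \<ge> 0" "\<delta> * shifted_energy u \<ge> 0"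
    using assms shifted_energy_nonneg by simp_all
  then show ?thesis
    using Jfun_decomposition[OF assms(2), of \<delta>] negative_part_bound[OF assms(1), of u] by linarith
qed

text \<open>
  Coercivity acts on the shifted energy, whereas the term \<open>a * norm (C u) powr s\<close> has to be controlled
  separately: it is small for small charges, and for \<open>\<delta> * norm (C u) > 2\<close> the last summand of the
  decomposition is at least \<open>\<delta> / 2\<close> times it.
\<close>

lemma Jfun_sublevel_bounds:
  assumes \<delta>: "\<delta> > 0"
  obtains K where "\<And>u. C u \<noteq> 0 \<Longrightarrow> Jfun a s E C \<delta> u \<le> B \<Longrightarrow>
    shifted_energy u \<le> K \<and> a * norm (C u) powr s \<le> K"
proof -
  define K where "K = max (max (2 * B / \<delta>) (a * (2 / \<delta>) powr s))
    ((B + a * (1 / \<delta>) powr (s - 1)) / \<delta>)"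
  have "shifted_energy u \<le> K \<and> a * norm (C u) powr s \<le> K"
    if u: "C u \<noteq> 0" "Jfun a s E C \<delta> u \<le> B" for u
  proof
    let ?neg = "a * norm (C u) powr (s - 1) * (\<delta> * norm (C u) - 1)"
    have nonneg: "shifted_energy u / norm (C u) \<ge> 0" "\<delta> * shifted_energy u \<ge> 0"
      using \<delta> shifted_energy_nonneg by simp_all
    then have "\<delta> * shifted_energy u \<le> B + a * (1 / \<delta>) powr (s - 1)"
      using Jfun_decomposition[OF u(1), of \<delta>] negative_part_bound[OF \<delta>, of u] u(2) by linarith
    then have "shifted_energy u \<le> (B + a * (1 / \<delta>) powr (s - 1)) / \<delta>"
      using \<delta> by (simp add: field_simps)
    then show "shifted_energy u \<le> K" by (simp add: K_def)
    show "a * norm (C u) powr s \<le> K"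
    proof (cases "\<delta> * norm (C u) \<le> 2")
      case True
      then have "norm (C u) \<le> 2 / \<delta>" using \<delta> by (simp add: field_simps)
      then have "a * norm (C u) powr s \<le> a * (2 / \<delta>) powr s"
        using parameters by (intro mult_left_mono powr_mono2) auto
      then show ?thesis by (simp add: K_def)
    next
      case False
      have "?neg \<le> B"
        using Jfun_decomposition[OF u(1), of \<delta>] nonneg u(2) by linarith
      moreover have "a * norm (C u) powr (s - 1) * (\<delta> * norm (C u) / 2) \<le> ?neg"
        using False parameters by (intro mult_left_mono) auto
      moreover have "norm (C u) powr s = norm (C u) * norm (C u) powr (s - 1)"
        using powr_mult_base[of "norm (C u)" "s - 1"] by simp
      ultimately have "a * norm (C u) powr s * \<delta> \<le> 2 * B"
        by (simp add: algebra_simps)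
      then have "a * norm (C u) powr s \<le> 2 * B / \<delta>"
        using \<delta> by (simp add: field_simps)
      then show ?thesis by (simp add: K_def)
    qed
  qed
  then show thesis using that by blast
qed

text \<open>
  For fixed charge the penalized functional is an increasing affine function of the energy, so both
  have the same minimizers on a charge level; a level that meets the global minimum of the
  penalized functional contains no other constrained minimizers.
\<close>

lemma constrained_minimizers_eq:
  assumes \<delta>: "\<delta> > 0" and v: "v \<in> minimizers (charged C) (Jfun a s E C \<delta>)"
  shows "minimizers {u. C u = C v} E
           = {u \<in> minimizers (charged C) (Jfun a s E C \<delta>). C u = C v}"
proof -
  let ?J = "Jfun a s E C \<delta>"
  have Cv: "C v \<noteq> 0" and v_min: "\<And>z. C z \<noteq> 0 \<Longrightarrow> ?J v \<le> ?J z"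
    using v by (auto simp: minimizers_def is_arg_min_def charged_def not_less)
  have pos: "1 / norm (C v) + \<delta> > 0" using \<delta> Cv by (simp add: add_nonneg_pos)
  have affine: "?J u = (1 / norm (C v) + \<delta>) * E u + \<delta> * (2 * a * norm (C v) powr s)"
    if "C u = C v" for u
    using that by (simp add: Jfun_def Lam_def Phi_def algebra_simps)
  have order: "E u < E z \<longleftrightarrow> ?J u < ?J z" if "C u = C v" "C z = C v" for u z
    using that pos by (simp add: affine mult_less_cancel_left)
  show ?thesis
  proof (intro equalityI subsetI)
    fix u assume "u \<in> minimizers {u. C u = C v} E"
    then have u: "C u = C v" "\<not> E v < E u"
      by (auto simp: minimizers_def is_arg_min_def)
    then have "?J u \<le> ?J v" using order[of v u] by simp
    then have "?J u \<le> ?J z" if "C z \<noteq> 0" for z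
      using v_min[OF that] by linarith
    then show "u \<in> {u \<in> minimizers (charged C) ?J. C u = C v}"
      using u(1) Cv by (auto simp: minimizers_def is_arg_min_def charged_def not_less)
  next
    fix u assume "u \<in> {u \<in> minimizers (charged C) ?J. C u = C v}"
    then have u: "C u = C v" "\<And>z. C z \<noteq> 0 \<Longrightarrow> \<not> ?J z < ?J u"
      by (auto simp: minimizers_def is_arg_min_def charged_def)
    have "\<not> E z < E u" if "C z = C v" for z
      using u(2)[of z] order[OF that u(1)] that Cv by simp
    then show "u \<in> minimizers {u. C u = C v} E"
      using u(1) by (simp add: minimizers_def is_arg_min_def)
  qed
qed

section \<open>Strong convergence of minimizing sequences\<close>

text \<open>
  If the charge vanished along a subsequence, boundedness of the ratio would make the energy vanish
  too. The subsequence would then tend to the origin in norm, against its nonzero weak limit.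
\<close>

lemma liminf_charge_pos:
  assumes u: "u \<noteq> 0" and weak: "weakly_converges (\<lambda>k. v k - u) 0"
    and charged: "\<And>k. C (v k) \<noteq> 0" and ratio: "Bseq (\<lambda>k. Lam E C (v k))"
  obtains m where "m > 0" "\<forall>\<^sub>F k in sequentially. norm (C (v k)) \<ge> m"
proof -
  have "\<exists>m>0. \<forall>\<^sub>F k in sequentially. norm (C (v k)) \<ge> m"
  proof (rule ccontr)
    assume "\<not> ?thesis"
    then have freq: "\<exists>\<^sub>F k in sequentially. norm (C (v k)) < 1 / (real n + 1)" for n
      unfolding frequently_def by (force simp: not_less)
    have "\<exists>q. strict_mono q \<and> (\<forall>n. norm (C (v (q n))) < 1 / (real n + 1))"
    proof -
      have next_index: "\<exists>k>i. norm (C (v k)) < 1 / (real n + 1)" for i n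
        using freq[of n] unfolding frequently_sequentially by (meson Suc_le_lessD)
      have "\<exists>q. \<forall>n. norm (C (v (q n))) < 1 / (real n + 1) \<and> q n < q (Suc n)"
        by (rule dependent_nat_choice) (use next_index in blast)+
      then show ?thesis using strict_mono_Suc_iff by blast
    qed
    then obtain q where q: "strict_mono q" "\<And>n. norm (C (v (q n))) < 1 / (real n + 1)" by blast
    have N0: "(\<lambda>n. norm (C (v (q n)))) \<longlonglongrightarrow> 0"
    proof (rule tendsto_sandwich[OF _ _ tendsto_const])
      show "(\<lambda>n. 1 / (real n + 1)) \<longlonglongrightarrow> 0"
        using LIMSEQ_inverse_real_of_nat by (simp add: inverse_eq_divide add.commute)
    qed (use q(2) in \<open>auto intro!: always_eventually less_imp_le\<close>)
    have "Bseq (\<lambda>n. Lam E C (v (q n)))"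
      using Bseq_subseq[OF ratio, of q] by (simp add: o_def)
    then have "(\<lambda>n. Lam E C (v (q n)) * norm (C (v (q n)))) \<longlonglongrightarrow> 0"
      using N0 by (rule tendsto_zero_mult_Bseq)
    then have E0: "(\<lambda>n. E (v (q n))) \<longlonglongrightarrow> 0"
      using charged by (simp add: Lam_def)
    have "(\<lambda>n. norm (C (v (q n))) powr s) \<longlonglongrightarrow> 0 powr s"
      using N0 parameters by (intro tendsto_powr') auto
    then have "(\<lambda>n. E (v (q n)) + a * norm (C (v (q n))) powr s) \<longlonglongrightarrow> 0 + a * 0 powr s"
      by (intro tendsto_add tendsto_mult tendsto_const E0)
    then have "(\<lambda>n. v (q n)) \<longlonglongrightarrow> 0"
      by (intro shifted_zero) simp
    moreover have "weakly_converges (\<lambda>n. v (q n) - u) 0"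
      using weak LIMSEQ_subseq_LIMSEQ[OF _ q(1)]
      unfolding weakly_converges_def o_def by blast
    ultimately show False using weak_limit_of_null_seq[of "\<lambda>n. v (q n)" u] u by simp
  qed
  then show thesis using that by blast
qed

text \<open>
  The heart of the argument. Write \<open>v k = u + w k\<close>. By splitting, the value at \<open>v k\<close> is
  asymptotically the value \<open>Q k\<close> computed from the sums of the energies and of the charges of \<open>u\<close> and
  \<open>w k\<close>. The ratio in \<open>Q k\<close> is a mediant and \<open>Phi\<close> is superadditive, so \<open>Q k\<close> is at least the
  functional at one of the two pieces plus \<open>\<delta>\<close> times \<open>Phi\<close> of the other one. As the functional at
  any piece is at least the infimum, the other piece must have vanishing \<open>Phi\<close>; it cannot be the
  fixed \<open>u \<noteq> 0\<close>, so it is \<open>w k\<close>.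
\<close>

lemma minimizing_weak_limit_is_strong:
  assumes \<delta>: "\<delta> > 0"
    and lower: "\<And>z. C z \<noteq> 0 \<Longrightarrow> j \<le> Jfun a s E C \<delta> z"
    and charged: "\<And>k. C (v k) \<noteq> 0"
    and lim: "(\<lambda>k. Jfun a s E C \<delta> (v k)) \<longlonglongrightarrow> j"
    and u: "u \<noteq> 0" and weak: "weakly_converges (\<lambda>k. v k - u) 0"
  shows "v \<longlonglongrightarrow> u \<and> C u \<noteq> 0 \<and> Jfun a s E C \<delta> u = j"
proof -
  let ?J = "Jfun a s E C \<delta>" and ?P = "Phi a s E C" and ?N = "\<lambda>z. norm (C z)"
  define w where "w k = v k - u" for k
  define e where "e k = E u + E (w k)" for k
  define n where "n k = ?N u + ?N (w k)" for k
  define Q where "Q k = e k / n k + \<delta> * (e k + 2 * a * n k powr s)" for k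
  have w: "weakly_converges w 0" using weak by (simp add: w_def[abs_def])
  have vw: "u + w k = v k" for k by (simp add: w_def)
  have dE: "(\<lambda>k. E (v k) - e k) \<longlonglongrightarrow> 0"
    using splitting_E[unfolded splitting_def, rule_format, OF w, of u] by (simp add: vw e_def)
  have dN: "(\<lambda>k. ?N (v k) - n k) \<longlonglongrightarrow> 0"
    using splitting_C[unfolded splitting_def, rule_format, OF w, of u] by (simp add: vw n_def)

  obtain B where B: "\<And>k. \<bar>?J (v k)\<bar> \<le> B"
    using convergent_imp_Bseq[OF convergentI[OF lim]] unfolding Bseq_def by auto
  obtain K where K: "\<And>k. shifted_energy (v k) \<le> K" "\<And>k. a * ?N (v k) powr s \<le> K"
    using Jfun_sublevel_bounds[OF \<delta>, of B] charged abs_le_D1[OF B] by metis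
  have ratio: "Bseq (\<lambda>k. Lam E C (v k))"
  proof (rule BseqI')
    fix k
    have "0 \<le> \<delta> * ?P (v k)" using \<delta> Phi_nonneg by simp
    moreover have "\<delta> * ?P (v k) \<le> \<delta> * (K + K)"
      using \<delta> K[of k] by (intro mult_left_mono) (auto simp: Phi_eq_shifted intro!: add_mono)
    ultimately show "norm (Lam E C (v k)) \<le> B + \<delta> * (K + K)"
      using B[of k] by (simp add: Jfun_def)
  qed

  obtain m where m: "m > 0" "\<forall>\<^sub>F k in sequentially. ?N (v k) \<ge> m"
    using liminf_charge_pos[OF u weak charged ratio] .
  have "\<forall>\<^sub>F k in sequentially. ?N (v k) - n k < m"
    using order_tendstoD(2)[OF dN m(1)] .
  then have n_pos: "\<forall>\<^sub>F k in sequentially. n k > 0"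
    using m(2) by eventually_elim linarith

  \<comment> \<open>The charges are known to be bounded if \<open>a > 0\<close>; for \<open>a = 0\<close> the power term is absent.\<close>
  have dPow: "(\<lambda>k. a * (?N (v k) powr s - n k powr s)) \<longlonglongrightarrow> 0"
  proof (cases "a = 0")
    case False
    then have a: "a > 0" using parameters by simp
    have "?N (v k) \<le> max 1 (K / a)" for k
    proof (cases "?N (v k) \<le> 1")
      case False
      then have "?N (v k) powr 1 \<le> ?N (v k) powr s" using parameters by (intro powr_mono) auto
      also have "\<dots> \<le> K / a" using a K(2)[of k] by (simp add: field_simps)
      finally show ?thesis using False by simp
    qed simp
    then have "Bseq (\<lambda>k. ?N (v k))" by (intro BseqI'[of _ "max 1 (K / a)"]) simp
    then have "(\<lambda>k. ?N (v k) powr s - n k powr s) \<longlonglongrightarrow> 0"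
      using dN parameters by (intro powr_diff_tendsto_zero) (auto simp: n_def)
    then show ?thesis by (rule tendsto_mult_right_zero)
  qed simp
  have dLam: "(\<lambda>k. E (v k) / ?N (v k) - e k / n k) \<longlonglongrightarrow> 0"
    using quotient_diff_tendsto_zero[OF dE dN m] ratio by (simp add: Lam_def)
  have "(\<lambda>k. (E (v k) / ?N (v k) - e k / n k)
      + \<delta> * ((E (v k) - e k) + 2 * (a * (?N (v k) powr s - n k powr s)))) \<longlonglongrightarrow> 0 + \<delta> * (0 + 2 * 0)"
    by (intro tendsto_intros dLam dE dPow)
  also have "(\<lambda>k. (E (v k) / ?N (v k) - e k / n k)
      + \<delta> * ((E (v k) - e k) + 2 * (a * (?N (v k) powr s - n k powr s)))) = (\<lambda>k. ?J (v k) - Q k)"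
    by (simp add: Jfun_def Lam_def Phi_def Q_def algebra_simps fun_eq_iff)
  finally have "(\<lambda>k. ?J (v k) - Q k) \<longlonglongrightarrow> 0" by simp
  from tendsto_diff[OF lim this] have Q: "Q \<longlonglongrightarrow> j" by simp

  have super: "e k / n k + \<delta> * (?P u + ?P (w k)) \<le> Q k" for k
  proof -
    have "2 * a * (?N u powr s + ?N (w k) powr s) \<le> 2 * a * n k powr s"
      unfolding n_def using parameters by (intro mult_left_mono powr_superadditive) auto
    then have "?P u + ?P (w k) \<le> e k + 2 * a * n k powr s"
      by (simp add: Phi_def e_def algebra_simps)
    then show ?thesis using \<delta> by (simp add: Q_def)
  qed
  have "j < j + \<delta> * ?P u" using \<delta> Phi_pos[OF u] by simp
  then have "\<forall>\<^sub>F k in sequentially. Q k < j + \<delta> * ?P u"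
    using order_tendstoD(2)[OF Q] by blast
  with n_pos have main: "\<forall>\<^sub>F k in sequentially. C u \<noteq> 0 \<and> ?J u + \<delta> * ?P (w k) \<le> Q k"
  proof eventually_elim
    case (elim k)
    show ?case
    proof (rule mediant_ge_one_fraction[of "?N u" "?N (w k)" "E u" "E (w k)"])
      assume "?N u > 0" "E u / ?N u \<le> (E u + E (w k)) / (?N u + ?N (w k))"
      then show ?thesis
        using super[of k] by (simp add: Jfun_def Lam_def e_def n_def distrib_left)
    next
      assume *: "?N (w k) > 0" "E (w k) / ?N (w k) \<le> (E u + E (w k)) / (?N u + ?N (w k))"
      then have "?J (w k) + \<delta> * ?P u \<le> Q k"
        using super[of k] by (simp add: Jfun_def Lam_def e_def n_def distrib_left)
      moreover have "j \<le> ?J (w k)" using lower * by simp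
      ultimately show ?thesis using elim(2) by linarith
    qed (use elim energy_nonneg_if_uncharged in \<open>auto simp: n_def\<close>)
  qed
  then have Cu: "C u \<noteq> 0"
    using eventually_happens'[OF sequentially_bot] by blast
  have "\<forall>\<^sub>F k in sequentially. ?J u \<le> Q k"
    using main
  proof eventually_elim
    case (elim k)
    have "\<delta> * ?P (w k) \<ge> 0" using \<delta> Phi_nonneg by simp
    then show ?case using elim by linarith
  qed
  then have "?J u \<le> j" by (rule tendsto_lowerbound[OF Q]) simp
  then have Ju: "?J u = j" using lower[OF Cu] by simp
  have "(\<lambda>k. shifted_energy (w k)) \<longlonglongrightarrow> 0"
  proof (rule tendsto_sandwich[OF _ _ tendsto_const])
    show "\<forall>\<^sub>F k in sequentially. shifted_energy (w k) \<le> (Q k - j) / \<delta>"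
      using main
    proof eventually_elim
      case (elim k)
      have "\<delta> * shifted_energy (w k) \<le> \<delta> * ?P (w k)"
        using \<delta> shifted_energy_le_Phi by simp
      then have "\<delta> * shifted_energy (w k) \<le> Q k - j" using elim Ju by linarith
      then show ?case using \<delta> by (simp add: field_simps)
    qed
    show "(\<lambda>k. (Q k - j) / \<delta>) \<longlonglongrightarrow> 0"
      using tendsto_divide[OF tendsto_diff[OF Q tendsto_const[of j]] tendsto_const[of \<delta>]] \<delta> by simp
  qed (simp add: shifted_energy_nonneg)
  then have "w \<longlonglongrightarrow> 0" using shifted_zero by (simp add: shifted_energy_def)
  then have "v \<longlonglongrightarrow> u" unfolding w_def[abs_def] by (simp add: LIM_zero_iff)
  then show ?thesis using Cu Ju by blast
qed

end

section \<open>Compactness up to the group action\<close>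

locale invariant_energy_charge = energy_charge E C a s
  for E :: "'x::real_normed_vector \<Rightarrow> real" and C :: "'x \<Rightarrow> real ^ 'l" and a s :: real +
  fixes G :: "('g, 'm) monoid_scheme" and \<phi> :: "'g \<Rightarrow> 'x \<Rightarrow> 'x" and p :: "'x \<Rightarrow> real"
  assumes invariant: "G_invariant_fun G \<phi> E" "G_invariant_fun G \<phi> C"
    and auxiliary: "auxiliary_seminorm G \<phi> p"
begin

lemma Jfun_invariant: "g \<in> carrier G \<Longrightarrow> Jfun a s E C \<delta> (\<phi> g u) = Jfun a s E C \<delta> u"
  using invariant by (simp add: G_invariant_fun_def Jfun_def Lam_def Phi_def)

text \<open>
  The hypothesis on \<open>\<epsilon>\<close> is what strict inequality below the vanishing threshold provides; it keeps the
  auxiliary seminorm away from zero along a minimizing sequence, which rules out a zero weak limit.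
\<close>

lemma minimizing_seq_converges_mod_group:
  assumes \<delta>: "\<delta> > 0"
    and lower: "\<And>z. C z \<noteq> 0 \<Longrightarrow> j \<le> Jfun a s E C \<delta> z"
    and charged: "\<And>k. C (u k) \<noteq> 0"
    and lim: "(\<lambda>k. Jfun a s E C \<delta> (u k)) \<longlonglongrightarrow> j"
    and \<epsilon>: "\<epsilon> > 0" "\<And>z. C z \<noteq> 0 \<Longrightarrow> p z < \<epsilon> \<Longrightarrow> Lam E C z > y" and y: "j < y"
  obtains r g ubar where "strict_mono (r :: nat \<Rightarrow> nat)" "\<And>k. g k \<in> carrier G"
    "(\<lambda>k. \<phi> (g k) (u (r k))) \<longlonglongrightarrow> ubar" "C ubar \<noteq> 0" "Jfun a s E C \<delta> ubar = j"
proof -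
  let ?J = "Jfun a s E C \<delta>"
  obtain n0 where n0: "\<And>n. n \<ge> n0 \<Longrightarrow> ?J (u n) < y"
    using order_tendstoD(2)[OF lim y] unfolding eventually_sequentially by blast
  define u' where "u' n = u (n + n0)" for n
  have Ju': "?J (u' n) < y" for n using n0 by (simp add: u'_def)
  have "p (u' n) \<ge> \<epsilon>" for n
  proof (rule ccontr)
    assume "\<not> ?thesis"
    then have "Lam E C (u' n) > y" using \<epsilon>(2) charged by (simp add: u'_def)
    moreover have "\<delta> * Phi a s E C (u' n) \<ge> 0" using \<delta> Phi_nonneg by simp
    ultimately show False using Ju'[of n] by (simp add: Jfun_def)
  qed
  moreover obtain K where "\<And>n. shifted_energy (u' n) \<le> K"
    using Jfun_sublevel_bounds[OF \<delta>, of y] charged Ju' unfolding u'_def by (metis less_imp_le)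
  then have "bounded (range u')" by (rule bounded_if_shifted_energy_bounded)
  ultimately obtain r g ubar where r: "strict_mono (r :: nat \<Rightarrow> nat)"
    and g: "\<And>k. g k \<in> carrier G" and ubar: "ubar \<noteq> 0"
    and weak: "weakly_converges (\<lambda>k. \<phi> (g k) (u' (r k))) ubar"
    using auxiliary \<epsilon>(1) unfolding auxiliary_seminorm_def by meson
  define v where "v k = \<phi> (g k) (u' (r k))" for k
  have r': "strict_mono (\<lambda>k. r k + n0)" using r by (simp add: strict_mono_def)
  have "weakly_converges (\<lambda>k. v k - ubar) 0"
    unfolding weakly_converges_def
  proof (intro allI impI)
    fix f :: "'x \<Rightarrow> real" assume f: "bounded_linear f"
    then have "(\<lambda>k. f (v k)) \<longlonglongrightarrow> f ubar"
      using weak unfolding weakly_converges_def v_def by blast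
    then show "(\<lambda>k. f (v k - ubar)) \<longlonglongrightarrow> f 0"
      using f by (simp add: linear_simps LIM_zero)
  qed
  moreover have "C (v k) \<noteq> 0" for k
    using charged g invariant(2) by (simp add: v_def u'_def G_invariant_fun_def)
  moreover have "(\<lambda>k. ?J (v k)) \<longlonglongrightarrow> j"
    using LIMSEQ_subseq_LIMSEQ[OF lim r'] Jfun_invariant[OF g] by (simp add: v_def u'_def o_def)
  ultimately have "v \<longlonglongrightarrow> ubar \<and> C ubar \<noteq> 0 \<and> ?J ubar = j"
    using minimizing_weak_limit_is_strong[OF \<delta> lower _ _ ubar] by blast
  then show thesis
    using that[of "\<lambda>k. r k + n0" g ubar] r' g unfolding v_def[abs_def] u'_def by simp
qed

lemma minimum_attained_and_compact:
  assumes \<delta>: "\<delta> > 0"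
    and \<epsilon>: "\<epsilon> > 0" "\<And>z. C z \<noteq> 0 \<Longrightarrow> p z < \<epsilon> \<Longrightarrow> Lam E C z > y"
    and z0: "C z0 \<noteq> 0" "Jfun a s E C \<delta> z0 < y"
  shows "minimizers (charged C) (Jfun a s E C \<delta>) \<noteq> {}"
    and "G_compact_fun G \<phi> (charged C) (Jfun a s E C \<delta>)"
proof -
  let ?J = "Jfun a s E C \<delta>" and ?I = "INF z\<in>charged C. ereal (Jfun a s E C \<delta> z)"
  have "ereal (- (a * (1 / \<delta>) powr (s - 1))) \<le> ?I"
    using Jfun_bounded_below[OF \<delta>] by (intro INF_greatest) (auto simp: charged_def)
  moreover have I_le: "?I \<le> ereal (?J z)" if "C z \<noteq> 0" for z
    using that by (intro INF_lower) (simp add: charged_def)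
  ultimately obtain j where j: "?I = ereal j"
    using z0(1) by (metis ereal_infty_less_eq2(1) ereal_infty_less_eq2(2) PInfty_neq_ereal(1)
        MInfty_neq_ereal(1) ereal_cases)
  have lower: "j \<le> ?J z" if "C z \<noteq> 0" for z
    using I_le[OF that] j by simp
  have y: "j < y" using lower[OF z0(1)] z0(2) by simp

  have "\<exists>z. C z \<noteq> 0 \<and> ?J z < j + 1 / (real n + 1)" for n
  proof -
    have "?I < ereal (j + 1 / (real n + 1))" by (simp add: j)
    then show ?thesis unfolding INF_less_iff by (auto simp: charged_def)
  qed
  then obtain u where u: "\<And>n. C (u n) \<noteq> 0" "\<And>n. ?J (u n) < j + 1 / (real n + 1)" by metis
  have "(\<lambda>n. ?J (u n)) \<longlonglongrightarrow> j"
  proof (rule tendsto_sandwich[OF _ _ tendsto_const])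
    show "(\<lambda>n. j + 1 / (real n + 1)) \<longlonglongrightarrow> j"
      using LIMSEQ_inverse_real_of_nat_add by (simp add: inverse_eq_divide add.commute)
  qed (use u lower in \<open>auto intro!: always_eventually less_imp_le\<close>)
  from minimizing_seq_converges_mod_group[OF \<delta> lower u(1) this \<epsilon> y]
  obtain ubar where "C ubar \<noteq> 0" "?J ubar = j" by blast
  then have "ubar \<in> minimizers (charged C) ?J"
    using lower by (auto simp: minimizers_def is_arg_min_def charged_def not_less)
  then show "minimizers (charged C) ?J \<noteq> {}" by blast

  show "G_compact_fun G \<phi> (charged C) ?J"
    unfolding G_compact_fun_def
  proof (intro allI impI)
    fix u assume "minimizing_seq (charged C) ?J u"
    then have u: "\<And>n. C (u n) \<noteq> 0" "(\<lambda>n. ?J (u n)) \<longlonglongrightarrow> j"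
      unfolding minimizing_seq_def j by (auto simp: charged_def)
    from minimizing_seq_converges_mod_group[OF \<delta> lower u \<epsilon> y]
    show "G_compact_seq G \<phi> u"
      unfolding G_compact_seq_def convergent_def by metis
  qed
qed

text \<open>
  A sequence of constrained minimizers is a minimizing sequence of the penalized functional, so the
  compactness of the latter carries over; closedness and invariance come from the description of the
  set as a level set of energy and charge.
\<close>

lemma constrained_minimizers_G_compact:
  assumes \<delta>: "\<delta> > 0" and v: "v \<in> minimizers (charged C) (Jfun a s E C \<delta>)"
    and compact: "G_compact_fun G \<phi> (charged C) (Jfun a s E C \<delta>)"
  shows "G_compact_set G \<phi> (minimizers {u. C u = C v} E)"
proof -
  let ?J = "Jfun a s E C \<delta>" and ?\<Gamma> = "minimizers {u. C u = C v} E"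
  have v\<Gamma>: "v \<in> ?\<Gamma>" using constrained_minimizers_eq[OF \<delta> v] v by blast
  have level: "?\<Gamma> = {u. C u = C v} \<inter> {u. E u = E v}"
    using v\<Gamma> by (auto simp: minimizers_def is_arg_min_def) (metis linorder_neqE_linordered_idom)
  have "closed ?\<Gamma>"
    unfolding level using continuous by (intro closed_Int closed_Collect_eq) auto
  moreover have "G_invariant_set G \<phi> ?\<Gamma>"
    unfolding G_invariant_set_def
  proof (intro conjI ballI)
    show "?\<Gamma> \<noteq> {}" using v\<Gamma> by blast
    show "\<phi> g u \<in> ?\<Gamma>" if "g \<in> carrier G" "u \<in> ?\<Gamma>" for g u
      using that invariant unfolding level G_invariant_fun_def by auto
  qed
  moreover have "\<exists>g r. (\<forall>n. g n \<in> carrier G) \<and> strict_mono (r :: nat \<Rightarrow> nat) \<and>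
      convergent ((\<lambda>n. \<phi> (g n) (u n)) \<circ> r)" if u: "\<forall>n. u n \<in> ?\<Gamma>" for u :: "nat \<Rightarrow> 'x"
  proof -
    have min: "u n \<in> minimizers (charged C) ?J" for n
      using u constrained_minimizers_eq[OF \<delta> v] by blast
    then have "ereal (?J (u n)) = (INF z\<in>charged C. ereal (?J z))" for n
      by (intro antisym INF_greatest INF_lower)
        (auto simp: minimizers_def is_arg_min_def not_less)
    then have "minimizing_seq (charged C) ?J u"
      using min by (simp add: minimizing_seq_def minimizers_def is_arg_min_def)
    then obtain r g where rg: "strict_mono r" "\<And>k. g k \<in> carrier G"
      "convergent (\<lambda>k. \<phi> (g k) (u (r k)))"
      using compact unfolding G_compact_fun_def G_compact_seq_def by blast
    \<comment> \<open>The group elements are reindexed along the original sequence; off the range of \<open>r\<close> any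
      element will do.\<close>
    have "inj r" using rg(1) strict_mono_imp_inj_on by blast
    then have "((\<lambda>n. \<phi> (g (inv_into UNIV r n)) (u n)) \<circ> r) = (\<lambda>k. \<phi> (g k) (u (r k)))"
      by (auto simp: fun_eq_iff)
    then show ?thesis using rg by (intro exI[of _ "\<lambda>n. g (inv_into UNIV r n)"] exI[of _ r]) simp
  qed
  ultimately show ?thesis unfolding G_compact_set_def by blast
qed

end

section \<open>Existence of hylomorphic minimizers\<close>

lemma class_C1_continuous_on: "class_C1 F \<Longrightarrow> continuous_on UNIV F"
  unfolding class_C1_def
  by (blast intro: continuous_at_imp_continuous_on has_derivative_continuous)

lemma Lam_gt_if_seminorm_small:
  fixes y :: real
  assumes p: "seminorm p" and y: "ereal y < Lam0 p E C"
  obtains \<epsilon> where "\<epsilon> > 0" "\<And>z. C z \<noteq> 0 \<Longrightarrow> p z < \<epsilon> \<Longrightarrow> Lam E C z > y"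
proof -
  have nonneg: "p z \<ge> 0" for z
  proof -
    have "p (z + (- 1) *\<^sub>R z) \<le> p z + p ((- 1) *\<^sub>R z)" "p ((- 1) *\<^sub>R z) = \<bar>- 1\<bar> * p z"
      "p (0 *\<^sub>R z) = \<bar>0\<bar> * p z"
      using p unfolding seminorm_def by blast+
    then show ?thesis by simp
  qed
  have "\<forall>\<^sub>F z in inf (filtercomap p (nhds 0)) (principal (charged C)). ereal y < ereal (Lam E C z)"
    using y unfolding Lam0_def by (rule less_LiminfD)
  then have "\<forall>\<^sub>F z in filtercomap p (nhds 0). C z \<noteq> 0 \<longrightarrow> y < Lam E C z"
    by (simp add: eventually_inf_principal charged_def)
  then obtain P where P: "eventually P (nhds 0)" "\<And>z. P (p z) \<Longrightarrow> C z \<noteq> 0 \<longrightarrow> y < Lam E C z"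
    unfolding eventually_filtercomap by blast
  then obtain \<epsilon> where "\<epsilon> > 0" "\<And>x. \<bar>x\<bar> < \<epsilon> \<Longrightarrow> P x"
    unfolding eventually_nhds_metric by (auto simp: dist_real_def)
  then show thesis using that P(2) nonneg by (metis abs_of_nonneg)
qed

theorem theorem15:
  fixes \<gamma> :: "real \<Rightarrow> 'x::banach \<Rightarrow> 'x"
    and G :: "('g, 'm) monoid_scheme"
    and \<phi> :: "'g \<Rightarrow> 'x \<Rightarrow> 'x"
    and E :: "'x \<Rightarrow> real"
    and C :: "'x \<Rightarrow> real ^ 'l"
    and a s :: real
    and sharp_norm :: "'x \<Rightarrow> real"
  assumes dyn: "flow \<gamma>"
    and action: "group_action G UNIV \<phi>"
    and C1: "class_C1 E" "class_C1 C"
    and EC1_integrals: "prime_integral \<gamma> E" "\<And>i. prime_integral \<gamma> (\<lambda>u. C u $ i)"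
    and EC1_zero: "E 0 = 0" "C 0 = 0"
    and EC1_deriv: "(E has_derivative (\<lambda>_. 0)) (at 0)" "(C has_derivative (\<lambda>_. 0)) (at 0)"
    and EC2: "G_invariant_fun G \<phi> E" "G_invariant_fun G \<phi> C"
    and EC3_const: "a \<ge> 0" "s \<ge> 1"
    and EC3_i: "\<And>u. E u + a * norm (C u) powr s \<ge> 0"
    and EC3_ii: "filterlim (\<lambda>u. E u + a * norm (C u) powr s) at_top at_infinity"
    and EC3_iii: "\<And>u :: nat \<Rightarrow> 'x.
          (\<lambda>n. E (u n) + a * norm (C (u n)) powr s) \<longlonglongrightarrow> 0 \<Longrightarrow> u \<longlonglongrightarrow> 0"
    and EC4: "splitting E" "splitting (\<lambda>u. norm (C u))"
    and aux: "auxiliary_seminorm G \<phi> sharp_norm"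
    and hylo: "(INF u\<in>charged C. ereal (Lam E C u)) < Lam0 sharp_norm E C"
  shows "\<exists>\<delta>bar > 0. \<exists>c :: real \<Rightarrow> real ^ 'l. \<forall>\<delta> \<in> {0<..<\<delta>bar}.
           (let \<Gamma> = minimizers {u. C u = c \<delta>} E;
                M = minimizers (charged C) (Jfun a s E C \<delta>)
            in \<Gamma> \<noteq> {} \<and>
               G_compact_set G \<phi> \<Gamma> \<and>
               \<Gamma> = {u \<in> M. C u = c \<delta>} \<and>
               M = (\<Union>v\<in>M. minimizers {u. C u = C v} E) \<and>
               G_compact_fun G \<phi> (charged C) (Jfun a s E C \<delta>))"
proof -
  interpret invariant_energy_charge E C a s G \<phi> sharp_norm
    using C1[THEN class_C1_continuous_on] EC1_zero EC3_const EC3_i EC3_ii EC3_iii EC4 EC2 aux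
    by unfold_locales
  let ?J = "\<lambda>\<delta>. Jfun a s E C \<delta>"
  let ?M = "\<lambda>\<delta>. minimizers (charged C) (?J \<delta>)"
  obtain z0 where z0: "C z0 \<noteq> 0" "ereal (Lam E C z0) < Lam0 sharp_norm E C"
    using hylo unfolding INF_less_iff by (auto simp: charged_def)
  then obtain y where y: "Lam E C z0 < y" "ereal y < Lam0 sharp_norm E C"
    using ereal_dense2 by (metis less_ereal.simps(1))
  obtain \<epsilon> where \<epsilon>: "\<epsilon> > 0" "\<And>z. C z \<noteq> 0 \<Longrightarrow> sharp_norm z < \<epsilon> \<Longrightarrow> Lam E C z > y"
    using Lam_gt_if_seminorm_small[OF _ y(2)] aux unfolding auxiliary_seminorm_def by blast
  \<comment> \<open>For such \<open>\<delta>\<close> the penalty keeps the value at \<open>z0\<close> below \<open>y\<close>.\<close>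
  define \<delta>bar where "\<delta>bar = (y - Lam E C z0) / (Phi a s E C z0 + 1)"
  have den: "Phi a s E C z0 + 1 > 0" using Phi_nonneg[of z0] by simp
  have \<delta>bar: "\<delta>bar > 0" using y den by (simp add: \<delta>bar_def)
  have J0: "?J \<delta> z0 < y" if "0 < \<delta>" "\<delta> < \<delta>bar" for \<delta>
  proof -
    have "\<delta> * (Phi a s E C z0 + 1) < y - Lam E C z0"
      using that den by (simp add: \<delta>bar_def field_simps)
    then show ?thesis using that by (simp add: Jfun_def distrib_left)
  qed
  define c where "c \<delta> = C (SOME v. v \<in> ?M \<delta>)" for \<delta>
  show ?thesis
  proof (intro exI[of _ \<delta>bar] conjI \<delta>bar exI[of _ c] ballI)
    fix \<delta> assume "\<delta> \<in> {0<..<\<delta>bar}"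
    then have \<delta>: "\<delta> > 0" "?J \<delta> z0 < y" using J0 by auto
    note min = minimum_attained_and_compact[OF \<delta>(1) \<epsilon> z0(1) \<delta>(2)]
    define v where "v = (SOME v. v \<in> ?M \<delta>)"
    have v: "v \<in> ?M \<delta>" unfolding v_def using min(1) some_in_eq by blast
    have cv: "c \<delta> = C v" by (simp add: c_def v_def)
    note eq = constrained_minimizers_eq[OF \<delta>(1)]
    have "?M \<delta> = (\<Union>v\<in>?M \<delta>. minimizers {u. C u = C v} E)"
      using eq by blast
    moreover have "minimizers {u. C u = C v} E \<noteq> {}"
      using eq[OF v] v by blast
    ultimately show "let \<Gamma> = minimizers {u. C u = c \<delta>} E; M = ?M \<delta>
        in \<Gamma> \<noteq> {} \<and> G_compact_set G \<phi> \<Gamma> \<and> \<Gamma> = {u \<in> M. C u = c \<delta>} \<and>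
           M = (\<Union>v\<in>M. minimizers {u. C u = C v} E) \<and> G_compact_fun G \<phi> (charged C) (?J \<delta>)"
      unfolding Let_def cv
      using eq[OF v] min(2) constrained_minimizers_G_compact[OF \<delta>(1) v min(2)] by blast
  qed
qed

end
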